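(* Let $R$ be a ring. Then the following three statements are equivalent: (1) $R$ is a semi-regular $UJ^{\#}$ ring and $J(R)$ is nil. (2) $R$ is an exchange $UJ^{\#}$ ring and $J(R)$ is nil. (3) $R$ is a strongly nil-clean ring.
   Context: All rings are associative with identity. $J(R)$ is the Jacobson radical and $U(R)$ the group of units of $R$. Define $J^{\#}(R)=\{z\in R : z^n\in J(R)\text{ for some } n\ge 1\}$. A ring $R$ is called a $UJ^{\#}$ ring if $U(R)=1+J^{\#}(R)$. A ring $R$ is semi-regular if $R/J(R)$ is von Neumann regular and idempotents lift modulo $J(R)$; exchange if for every $a\in R$ there is an idempotent $e\in aR$ with $1-e\in(1-a)R$; strongly nil-clean if every $a\in R$ can be written $a=e+q$ with $e$ idempotent, $q$ nilpotent and $eq=qe$. *)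

theory Defs
  imports "HOL-Algebra.QuotRing"
begin

definition right_ideal :: "'a set \<Rightarrow> ('a, 'b) ring_scheme \<Rightarrow> bool" where
  "right_ideal I R \<longleftrightarrow>
     additive_subgroup I R \<and> (\<forall>a\<in>I. \<forall>x\<in>carrier R. a \<otimes>\<^bsub>R\<^esub> x \<in> I)"

definition maximal_right_ideal :: "'a set \<Rightarrow> ('a, 'b) ring_scheme \<Rightarrow> bool" where
  "maximal_right_ideal M R \<longleftrightarrow>
     right_ideal M R \<and> M \<noteq> carrier R \<and>
     (\<forall>N. right_ideal N R \<and> M \<subseteq> N \<longrightarrow> N = M \<or> N = carrier R)"

(* Intersecting with the carrier only matters for the zero ring, which has no
   maximal right ideals and is its own radical. *)
definition jacobson_radical :: "('a, 'b) ring_scheme \<Rightarrow> 'a set" where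
  "jacobson_radical R = carrier R \<inter> \<Inter>{M. maximal_right_ideal M R}"

definition jacobson_sharp :: "('a, 'b) ring_scheme \<Rightarrow> 'a set" where
  "jacobson_sharp R =
     {z \<in> carrier R. \<exists>n::nat. n \<ge> 1 \<and> z [^]\<^bsub>R\<^esub> n \<in> jacobson_radical R}"

(* The right-hand side is the coset 1 + J#(R), where <+ is the library's
   additive left coset (of an arbitrary subset of the carrier). *)
definition UJ_sharp :: "('a, 'b) ring_scheme \<Rightarrow> bool" where
  "UJ_sharp R \<longleftrightarrow> Units R = \<one>\<^bsub>R\<^esub> <+\<^bsub>R\<^esub> jacobson_sharp R"

definition idempotents :: "('a, 'b) ring_scheme \<Rightarrow> 'a set" where
  "idempotents R = {e \<in> carrier R. e \<otimes>\<^bsub>R\<^esub> e = e}"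

definition nilpotents :: "('a, 'b) ring_scheme \<Rightarrow> 'a set" where
  "nilpotents R = {q \<in> carrier R. \<exists>n::nat. n \<ge> 1 \<and> q [^]\<^bsub>R\<^esub> n = \<zero>\<^bsub>R\<^esub>}"

definition nil_subset :: "'a set \<Rightarrow> ('a, 'b) ring_scheme \<Rightarrow> bool" where
  "nil_subset I R \<longleftrightarrow> I \<subseteq> nilpotents R"

definition von_neumann_regular :: "('a, 'b) ring_scheme \<Rightarrow> bool" where
  "von_neumann_regular R \<longleftrightarrow>
     (\<forall>a\<in>carrier R. \<exists>x\<in>carrier R. a = a \<otimes>\<^bsub>R\<^esub> x \<otimes>\<^bsub>R\<^esub> a)"

definition idempotents_lift_modulo :: "'a set \<Rightarrow> ('a, 'b) ring_scheme \<Rightarrow> bool" where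
  "idempotents_lift_modulo I R \<longleftrightarrow>
     (\<forall>f\<in>idempotents (R Quot I). \<exists>e\<in>idempotents R. I +>\<^bsub>R\<^esub> e = f)"

definition semi_regular :: "('a, 'b) ring_scheme \<Rightarrow> bool" where
  "semi_regular R \<longleftrightarrow>
     von_neumann_regular (R Quot jacobson_radical R) \<and>
     idempotents_lift_modulo (jacobson_radical R) R"

definition exchange_ring :: "('a, 'b) ring_scheme \<Rightarrow> bool" where
  "exchange_ring R \<longleftrightarrow>
     (\<forall>a\<in>carrier R. \<exists>e\<in>idempotents R.
        e \<in> a <#\<^bsub>R\<^esub> carrier R \<and>
        \<one>\<^bsub>R\<^esub> \<ominus>\<^bsub>R\<^esub> e \<in> (\<one>\<^bsub>R\<^esub> \<ominus>\<^bsub>R\<^esub> a) <#\<^bsub>R\<^esub> carrier R)"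

definition strongly_nil_clean :: "('a, 'b) ring_scheme \<Rightarrow> bool" where
  "strongly_nil_clean R \<longleftrightarrow>
     (\<forall>a\<in>carrier R. \<exists>e\<in>idempotents R. \<exists>q\<in>nilpotents R.
        a = e \<oplus>\<^bsub>R\<^esub> q \<and> e \<otimes>\<^bsub>R\<^esub> q = q \<otimes>\<^bsub>R\<^esub> e)"

end

theory Submission
  imports Defs "HOL-Algebra.Subrings"
begin

text \<open>
  If $J(R)$ is nil, then $J^{\#}(R)$ is the set of nilpotents, so the $UJ^{\#}$ condition with $J(R)$
  nil says that every unit is unipotent.  In an exchange ring $R$ with unipotent units, $a^2 \in J(R)$
  implies $a \in J(R)$: otherwise $aR$ contains a nonzero idempotent, which produces $2 \times 2$
  matrix units and hence a unit that is not unipotent (an argument of Levitzki).  So all nilpotents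
  lie in $J(R)$.  For an exchange idempotent $e$ of $a$, the element $a - (1 - e)$ is then
  invertible modulo $J(R)$, hence a unit, hence congruent to $1$; as $2 \in J(R)$, it follows that
  $a - a^2 \in J(R)$.  Lifting an idempotent polynomially in $a$ gives the strongly nil-clean
  decomposition, and $R/J(R)$ is Boolean, which gives semi-regularity.
\<close>

subsection \<open>Units and nilpotent elements\<close>

text \<open>Nilpotents of a noncommutative ring need not be closed under sums or products, so the
  unit test "1 minus a nilpotent" cannot be applied to a sum of nilpotents. Hence they are first
  placed inside the ideal J(R); after that the invertibility of a - (1 - e) costs only two Peirce
  corners of square zero. The choice of a - (1 - e) can be guessed from the goal: if R/J(R) is
  Boolean, then e has the same class as a, and a - (1 - e) becomes 2a - 1 = 1. That 2 lies in J(R)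
  comes from the unit -1, which must be unipotent like every other unit. The radical, taken over
  maximal right ideals, and the exchange condition are both one-sided, so the direct constructions
  give right inverses. Two-sidedness is gained for the radical by passing from 1 - ab to 1 - ba, and
  for units by the element v(1 - vu), which has square zero when uv = 1.\<close>

context ring
begin

text \<open>The library sets up the \<open>algebra\<close> method for rings without the right unit law.\<close>
lemmas [algebra ring "zero R" "add R" "a_inv R" "a_minus R" "one R" "mult R"] = r_one

lemma Units_right_cancel:
  assumes "u \<in> Units R" "x \<otimes> u = y \<otimes> u" "x \<in> carrier R" "y \<in> carrier R"
  shows "x = y"
  using assms by (metis Units_closed Units_inv_closed Units_r_inv m_assoc r_one)

lemma Units_two_sided:
  assumes "x \<in> carrier R" "l \<in> carrier R" "r \<in> carrier R" "l \<otimes> x = \<one>" "x \<otimes> r = \<one>"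
  shows "x \<in> Units R"
proof -
  have "l = r" using assms by (metis inv_unique)
  then show ?thesis using assms unfolding Units_def by auto
qed

text \<open>Formally, 1 + ba + baba + ... = 1 + b(1 + ab + ...)a, which suggests
  \<open>\<one> \<oplus> b \<otimes> v \<otimes> a\<close> as the inverse. The equations
  \<open>l\<close> and \<open>r\<close> restate that \<open>v\<close> is an inverse on either side,
  in the form that makes the surplus terms cancel.\<close>

lemma Units_one_minus_swap:
  assumes ab: "a \<in> carrier R" "b \<in> carrier R" and u: "\<one> \<ominus> a \<otimes> b \<in> Units R"
  shows "\<one> \<ominus> b \<otimes> a \<in> Units R"
proof -
  define v where "v = inv (\<one> \<ominus> a \<otimes> b)"
  have v: "v \<in> carrier R" using u by (simp add: v_def)
  have l: "v = \<one> \<oplus> v \<otimes> a \<otimes> b"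
  proof -
    have "v \<otimes> (\<one> \<ominus> a \<otimes> b) = \<one>" using u by (simp add: v_def)
    then have "\<one> \<oplus> v \<otimes> a \<otimes> b = v \<otimes> (\<one> \<ominus> a \<otimes> b) \<oplus> v \<otimes> a \<otimes> b" by simp
    also have "\<dots> = v" using ab v by algebra
    finally show ?thesis by simp
  qed
  have r: "v = \<one> \<oplus> a \<otimes> b \<otimes> v"
  proof -
    have "(\<one> \<ominus> a \<otimes> b) \<otimes> v = \<one>" using u by (simp add: v_def)
    then have "\<one> \<oplus> a \<otimes> b \<otimes> v = (\<one> \<ominus> a \<otimes> b) \<otimes> v \<oplus> a \<otimes> b \<otimes> v" by simp
    also have "\<dots> = v" using ab v by algebra
    finally show ?thesis by simp
  qed
  let ?w = "\<one> \<oplus> b \<otimes> v \<otimes> a"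
  have "?w \<otimes> (\<one> \<ominus> b \<otimes> a) = \<one> \<oplus> b \<otimes> v \<otimes> a \<ominus> b \<otimes> (\<one> \<oplus> v \<otimes> a \<otimes> b) \<otimes> a"
    using ab v by algebra
  also have "\<dots> = \<one>" using ab v l[symmetric] by (simp add: minus_eq a_assoc r_neg)
  finally have 1: "?w \<otimes> (\<one> \<ominus> b \<otimes> a) = \<one>" .
  have "(\<one> \<ominus> b \<otimes> a) \<otimes> ?w = \<one> \<oplus> b \<otimes> v \<otimes> a \<ominus> b \<otimes> (\<one> \<oplus> a \<otimes> b \<otimes> v) \<otimes> a"
    using ab v by algebra
  also have "\<dots> = \<one>" using ab v r[symmetric] by (simp add: minus_eq a_assoc r_neg)
  finally have 2: "(\<one> \<ominus> b \<otimes> a) \<otimes> ?w = \<one>" .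
  show ?thesis by (rule Units_two_sided[OF _ _ _ 1 2]) (use ab v in auto)
qed

text \<open>The witness is 1 + q + ... + q^(n-1). One element serves both sides, so a nilpotent
  \<open>q\<close> yields a two-sided inverse of 1 - q.\<close>

lemma one_minus_geometric:
  assumes q: "q \<in> carrier R"
  shows "\<exists>s\<in>carrier R. (\<one> \<ominus> q) \<otimes> s = \<one> \<ominus> q [^] (n::nat) \<and> s \<otimes> (\<one> \<ominus> q) = \<one> \<ominus> q [^] n"
proof (induction n)
  case 0
  show ?case using q by (auto intro!: bexI[of _ \<zero>] simp: minus_eq r_neg)
next
  case (Suc n)
  then obtain s where s: "s \<in> carrier R" "(\<one> \<ominus> q) \<otimes> s = \<one> \<ominus> q [^] n" "s \<otimes> (\<one> \<ominus> q) = \<one> \<ominus> q [^] n"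
    by blast
  have p: "q [^] n \<in> carrier R" using q by simp
  have "(\<one> \<ominus> q) \<otimes> (s \<oplus> q [^] n) = (\<one> \<ominus> q [^] n) \<oplus> (q [^] n \<ominus> q \<otimes> q [^] n)"
    unfolding s(2)[symmetric] using s(1) p q by algebra
  also have "\<dots> = \<one> \<ominus> q [^] Suc n" unfolding nat_pow_Suc2[OF q] using p q by algebra
  finally have 1: "(\<one> \<ominus> q) \<otimes> (s \<oplus> q [^] n) = \<one> \<ominus> q [^] Suc n" .
  have "(s \<oplus> q [^] n) \<otimes> (\<one> \<ominus> q) = (\<one> \<ominus> q [^] n) \<oplus> (q [^] n \<ominus> q [^] n \<otimes> q)"
    unfolding s(3)[symmetric] using s(1) p q by algebra
  also have "\<dots> = \<one> \<ominus> q [^] Suc n" unfolding nat_pow_Suc using p q by algebra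
  finally show ?case using 1 s(1) p by blast
qed

lemma nilpotents_closed: "q \<in> nilpotents R \<Longrightarrow> q \<in> carrier R"
  by (simp add: nilpotents_def)

text \<open>Spares later proofs the positivity of the exponent: one more factor \<open>q\<close>
  turns exponent 0, possible only if 1 = 0, into an admissible one.\<close>

lemma nilpotentsI: "q \<in> carrier R \<Longrightarrow> q [^] (n::nat) = \<zero> \<Longrightarrow> q \<in> nilpotents R"
proof -
  assume q: "q \<in> carrier R" "q [^] n = \<zero>"
  then have "q [^] Suc n = \<zero>" by simp
  with q(1) show "q \<in> nilpotents R" unfolding nilpotents_def by (auto intro!: exI[of _ "Suc n"])
qed

lemma nilpotents_mult_commute:
  assumes "q \<in> nilpotents R" "t \<in> carrier R" "q \<otimes> t = t \<otimes> q"
  shows "q \<otimes> t \<in> nilpotents R"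
proof -
  obtain n :: nat where n: "q \<in> carrier R" "q [^] n = \<zero>"
    using assms(1) by (auto simp: nilpotents_def)
  then have "(q \<otimes> t) [^] n = \<zero>" using assms by (simp add: pow_mult_distrib)
  then show ?thesis using n assms by (intro nilpotentsI) auto
qed

lemma nilpotents_uminus: "q \<in> nilpotents R \<Longrightarrow> \<ominus> q \<in> nilpotents R"
  using nilpotents_mult_commute[of q "\<ominus> \<one>"] by (simp add: nilpotents_closed l_minus r_minus)

lemma Units_one_minus_nilpotent:
  assumes "q \<in> nilpotents R"
  shows "\<one> \<ominus> q \<in> Units R"
proof -
  obtain n :: nat where n: "q \<in> carrier R" "q [^] n = \<zero>"
    using assms by (auto simp: nilpotents_def)
  obtain s where "s \<in> carrier R" "(\<one> \<ominus> q) \<otimes> s = \<one>" "s \<otimes> (\<one> \<ominus> q) = \<one>"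
    using one_minus_geometric[OF n(1), of n] n by (auto simp: minus_eq)
  then show ?thesis using n(1) by (intro Units_two_sided) auto
qed

lemma Units_one_plus_nilpotent: "q \<in> nilpotents R \<Longrightarrow> \<one> \<oplus> q \<in> Units R"
  using Units_one_minus_nilpotent[OF nilpotents_uminus, of q] by (simp add: minus_eq nilpotents_closed)

lemma idempotent_pow: "h \<in> carrier R \<Longrightarrow> h \<otimes> h = h \<Longrightarrow> h [^] Suc n = h"
  by (induction n) auto

lemma idempotent_nilpotent_zero:
  assumes "h \<in> nilpotents R" "h \<otimes> h = h"
  shows "h = \<zero>"
proof -
  obtain n :: nat where n: "h \<in> carrier R" "n \<ge> 1" "h [^] n = \<zero>"
    using assms(1) by (auto simp: nilpotents_def)
  then show ?thesis using idempotent_pow[of h "n - 1"] assms(2) by simp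
qed

lemma idempotent_unit_one:
  assumes "h \<in> Units R" "h \<otimes> h = h"
  shows "h = \<one>"
  using assms Units_right_cancel[of h h \<one>] by auto

subsection \<open>The Jacobson radical\<close>

text \<open>Used with M = {0}, where it gives the principal right ideal (1 - x)R, and with a maximal
  M, where M + xR has to be the whole ring.\<close>

lemma right_ideal_principal_sum:
  assumes M: "right_ideal M R" and x: "x \<in> carrier R"
  shows "right_ideal {m \<oplus> x \<otimes> y | m y. m \<in> M \<and> y \<in> carrier R} R" (is "right_ideal ?N R")
proof -
  interpret M: additive_subgroup M R using M by (simp add: right_ideal_def)
  have Mr: "\<And>a y. a \<in> M \<Longrightarrow> y \<in> carrier R \<Longrightarrow> a \<otimes> y \<in> M"
    using M by (simp add: right_ideal_def)
  have 1: "?N \<subseteq> carrier R" using x by auto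
  have "subgroup ?N (add_monoid R)"
  proof (rule add.subgroupI)
    show "?N \<subseteq> carrier R" by (rule 1)
    show "?N \<noteq> {}" using M.zero_closed by blast
  next
    fix a assume "a \<in> ?N"
    then obtain m y where a: "a = m \<oplus> x \<otimes> y" "m \<in> M" "y \<in> carrier R" by blast
    have "\<ominus> a = \<ominus> m \<oplus> x \<otimes> (\<ominus> y)" using a x by (simp add: minus_add r_minus)
    then show "\<ominus> a \<in> ?N" using M.a_inv_closed[OF a(2)] a_inv_closed[OF a(3)] by blast
  next
    fix a b assume "a \<in> ?N" "b \<in> ?N"
    then obtain m y m' y' where a: "a = m \<oplus> x \<otimes> y" "m \<in> M" "y \<in> carrier R"
      and b: "b = m' \<oplus> x \<otimes> y'" "m' \<in> M" "y' \<in> carrier R" by blast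
    have "m \<in> carrier R" "m' \<in> carrier R" using a b by auto
    then have "a \<oplus> b = (m \<oplus> m') \<oplus> x \<otimes> (y \<oplus> y')" using a(1,3) b(1,3) x by algebra
    then show "a \<oplus> b \<in> ?N"
      using M.a_closed[OF a(2) b(2)] a_closed[OF a(3) b(3)] by blast
  qed
  moreover have "a \<otimes> r \<in> ?N" if ar: "a \<in> ?N" "r \<in> carrier R" for a r
  proof -
    obtain m y where a: "a = m \<oplus> x \<otimes> y" "m \<in> M" "y \<in> carrier R" using ar(1) by blast
    have "a \<otimes> r = m \<otimes> r \<oplus> x \<otimes> (y \<otimes> r)" using a x ar by (simp add: l_distr m_assoc)
    then show ?thesis using Mr[OF a(2) ar(2)] m_closed[OF a(3) ar(2)] by blast
  qed
  ultimately show ?thesis unfolding right_ideal_def by (intro conjI ballI additive_subgroup.intro)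
qed

lemma right_ideal_zero: "right_ideal {\<zero>} R"
  unfolding right_ideal_def by (auto intro!: additive_subgroup.intro add.triv_subgroup)

lemma right_ideal_one:
  assumes "right_ideal I R" "\<one> \<in> I"
  shows "I = carrier R"
proof
  show "I \<subseteq> carrier R" using assms by (simp add: right_ideal_def additive_subgroup.a_subset)
  show "carrier R \<subseteq> I"
  proof
    fix x assume "x \<in> carrier R"
    then show "x \<in> I" using assms l_one[of x] by (force simp: right_ideal_def)
  qed
qed

text \<open>Zorn is applied to the right ideals that avoid \<open>\<one>\<close>. By
  \<open>right_ideal_one\<close> this is properness, in a form that visibly passes to the union of a
  chain.\<close>

lemma exists_maximal_right_ideal:
  assumes I: "right_ideal I R" "\<one> \<notin> I"
  shows "\<exists>M. maximal_right_ideal M R \<and> I \<subseteq> M"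
proof -
  let ?A = "{N. right_ideal N R \<and> I \<subseteq> N \<and> \<one> \<notin> N}"
  have "\<exists>M\<in>?A. \<forall>X\<in>?A. M \<subseteq> X \<longrightarrow> X = M"
  proof (rule subset_Zorn_nonempty)
    show "?A \<noteq> {}" using I by (auto intro!: exI[of _ I])
  next
    fix C assume ne: "C \<noteq> {}" and C: "subset.chain ?A C"
    have mem: "\<And>N. N \<in> C \<Longrightarrow> right_ideal N R \<and> I \<subseteq> N \<and> \<one> \<notin> N"
      and lin: "\<And>N N'. N \<in> C \<Longrightarrow> N' \<in> C \<Longrightarrow> N \<subseteq> N' \<or> N' \<subseteq> N"
      using C unfolding subset_chain_def by blast+
    have sg: "subgroup N (add_monoid R)" if "N \<in> C" for N
      using mem[OF that] by (simp add: right_ideal_def additive_subgroup_def)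
    obtain N0 where N0: "N0 \<in> C" using ne by blast
    have "subgroup (\<Union>C) (add_monoid R)"
    proof (rule add.subgroupI)
      show "\<Union>C \<subseteq> carrier R" using subgroup.subset[OF sg] by (simp add: Union_least)
      have "\<zero> \<in> N0" using subgroup.one_closed[OF sg[OF N0]] by simp
      then show "\<Union>C \<noteq> {}" using N0 by blast
    next
      fix a assume "a \<in> \<Union>C"
      then obtain N where N: "N \<in> C" "a \<in> N" by (rule UnionE)
      have "\<ominus> a \<in> N" using subgroup.m_inv_closed[OF sg[OF N(1)] N(2)] by (simp add: a_inv_def)
      then show "\<ominus> a \<in> \<Union>C" by (rule UnionI[OF N(1)])
    next
      fix a b assume "a \<in> \<Union>C" "b \<in> \<Union>C"
      then obtain N1 N2 where "N1 \<in> C" "N2 \<in> C" "a \<in> N1" "b \<in> N2" by (elim UnionE)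
      then obtain N where N: "N \<in> C" "a \<in> N" "b \<in> N" using lin[of N1 N2] by fast
      then have "a \<oplus> b \<in> N" using subgroup.m_closed[OF sg, of N a b] by simp
      then show "a \<oplus> b \<in> \<Union>C" by (rule UnionI[OF N(1)])
    qed
    moreover have "\<forall>a\<in>\<Union>C. \<forall>x\<in>carrier R. a \<otimes> x \<in> \<Union>C"
    proof (intro ballI, elim UnionE)
      fix a x N assume "x \<in> carrier R" "N \<in> C" "a \<in> N"
      then show "a \<otimes> x \<in> \<Union>C" using mem[of N] UnionI[of N C] by (simp add: right_ideal_def)
    qed
    ultimately have "right_ideal (\<Union>C) R" by (simp only: right_ideal_def additive_subgroup_def)
    moreover have "I \<subseteq> \<Union>C"
      using mem[OF N0] N0 by (simp add: Sup_upper2)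
    moreover have "\<one> \<notin> \<Union>C" using mem by simp
    ultimately show "\<Union>C \<in> ?A" by simp
  qed
  then obtain M where MA: "M \<in> ?A" and max': "\<forall>X\<in>?A. M \<subseteq> X \<longrightarrow> X = M" by (rule bexE)
  have M: "right_ideal M R" "I \<subseteq> M" "\<one> \<notin> M" using MA by auto
  have max: "X = M" if "right_ideal X R" "\<one> \<notin> X" "M \<subseteq> X" for X
    using bspec[OF max', of X] that M(2) by auto
  have "maximal_right_ideal M R" unfolding maximal_right_ideal_def
  proof (intro conjI allI impI)
    show "M \<noteq> carrier R" using M(3) one_closed by blast
    show "N = M \<or> N = carrier R" if "right_ideal N R \<and> M \<subseteq> N" for N
      using that max[of N] right_ideal_one[of N] by blast
  qed (rule M(1))
  then show ?thesis using M(2) by blast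
qed

lemma jacobson_radical_closed: "x \<in> jacobson_radical R \<Longrightarrow> x \<in> carrier R"
  by (simp add: jacobson_radical_def)

lemma right_ideal_jacobson_radical: "right_ideal (jacobson_radical R) R"
proof -
  have M: "\<zero> \<in> M \<and> (\<forall>a\<in>M. \<ominus> a \<in> M) \<and> (\<forall>a\<in>M. \<forall>b\<in>M. a \<oplus> b \<in> M) \<and> (\<forall>a\<in>M. \<forall>x\<in>carrier R. a \<otimes> x \<in> M)"
    if "maximal_right_ideal M R" for M
  proof -
    interpret additive_subgroup M R
      using that by (simp add: maximal_right_ideal_def right_ideal_def)
    show ?thesis using that by (simp add: maximal_right_ideal_def right_ideal_def)
  qed
  have "subgroup (jacobson_radical R) (add_monoid R)"
  proof (rule add.subgroupI)
    have "\<zero> \<in> jacobson_radical R" using M by (simp add: jacobson_radical_def)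
    then show "jacobson_radical R \<noteq> {}" by blast
    show "\<ominus> a \<in> jacobson_radical R" if "a \<in> jacobson_radical R" for a
      using that M by (simp add: jacobson_radical_def)
    show "a \<oplus> b \<in> jacobson_radical R"
      if "a \<in> jacobson_radical R" "b \<in> jacobson_radical R" for a b
      using that M by (simp add: jacobson_radical_def)
  qed (auto simp: jacobson_radical_def)
  then show ?thesis unfolding right_ideal_def
    using M by (simp add: additive_subgroup_def jacobson_radical_def)
qed

text \<open>If (1 - x)R were proper, a maximal right ideal would contain it; that ideal also
  contains x, hence 1.\<close>

lemma right_inverse_one_minus_jacobson:
  assumes x: "x \<in> jacobson_radical R"
  shows "\<exists>s\<in>carrier R. (\<one> \<ominus> x) \<otimes> s = \<one>"
proof (rule ccontr)
  assume no: "\<not> ?thesis"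
  have xc: "x \<in> carrier R" using x by (rule jacobson_radical_closed)
  let ?I = "{m \<oplus> (\<one> \<ominus> x) \<otimes> y | m y. m \<in> {\<zero>} \<and> y \<in> carrier R}"
  have I: "right_ideal ?I R" by (rule right_ideal_principal_sum[OF right_ideal_zero]) (use xc in simp)
  have "\<one> \<notin> ?I" using no xc by auto
  then obtain M where M: "maximal_right_ideal M R" "?I \<subseteq> M"
    using exists_maximal_right_ideal[OF I] by blast
  have Mr: "right_ideal M R" "M \<noteq> carrier R" using M by (auto simp: maximal_right_ideal_def)
  interpret M: additive_subgroup M R using Mr by (simp add: right_ideal_def)
  have "x \<in> M" using x M(1) by (simp add: jacobson_radical_def)
  moreover have "\<one> \<ominus> x \<in> M"
  proof -
    have "\<one> \<ominus> x = \<zero> \<oplus> (\<one> \<ominus> x) \<otimes> \<one>" using xc by simp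
    then show ?thesis using M(2) by blast
  qed
  ultimately have "(\<one> \<ominus> x) \<oplus> x \<in> M" by simp
  moreover have "(\<one> \<ominus> x) \<oplus> x = \<one>" using xc by algebra
  ultimately show False using right_ideal_one Mr by auto
qed

text \<open>The right inverse s of 1 - x equals 1 + xs, which is again of the form 1 minus an
  element of the radical and so has a right inverse t. An element with inverses on both sides has
  them equal, so t = 1 - x.\<close>

lemma Units_one_minus_jacobson:
  assumes x: "x \<in> jacobson_radical R"
  shows "\<one> \<ominus> x \<in> Units R"
proof -
  have xc: "x \<in> carrier R" using x by (rule jacobson_radical_closed)
  interpret J: additive_subgroup "jacobson_radical R" R
    using right_ideal_jacobson_radical by (simp add: right_ideal_def)
  obtain s where s: "s \<in> carrier R" "(\<one> \<ominus> x) \<otimes> s = \<one>"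
    using right_inverse_one_minus_jacobson[OF x] by blast
  have "x \<otimes> s \<in> jacobson_radical R"
    using right_ideal_jacobson_radical x s by (simp add: right_ideal_def)
  then obtain t where t: "t \<in> carrier R" "(\<one> \<ominus> \<ominus> (x \<otimes> s)) \<otimes> t = \<one>"
    using right_inverse_one_minus_jacobson[of "\<ominus> (x \<otimes> s)"] J.a_inv_closed by blast
  have "\<one> \<ominus> \<ominus> (x \<otimes> s) = (\<one> \<ominus> x) \<otimes> s \<oplus> x \<otimes> s"
    using s xc by (simp add: minus_eq)
  also have "\<dots> = s" using s(1) xc by algebra
  finally have "s \<otimes> t = \<one>" using t by simp
  then have "\<one> \<ominus> x = t" using inv_unique[of "\<one> \<ominus> x" s t] s t(1) xc by simp
  then show ?thesis using Units_two_sided[of t s s] s t(1) \<open>s \<otimes> t = \<one>\<close> by auto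
qed

text \<open>Some maximal right ideal M omits x, so 1 = m + xy with m in M, and m = 1 - xy generates
  a proper right ideal. Excluding right inverses, rather than merely units, is what the exchange
  argument will contradict.\<close>

lemma not_jacobson_no_right_inverse:
  assumes x: "x \<in> carrier R" "x \<notin> jacobson_radical R"
  shows "\<exists>y\<in>carrier R. \<forall>s\<in>carrier R. (\<one> \<ominus> x \<otimes> y) \<otimes> s \<noteq> \<one>"
proof -
  obtain M where M: "maximal_right_ideal M R" "x \<notin> M" using x by (auto simp: jacobson_radical_def)
  have Mr: "right_ideal M R" "M \<noteq> carrier R" using M by (auto simp: maximal_right_ideal_def)
  interpret M: additive_subgroup M R using Mr by (simp add: right_ideal_def)
  let ?N = "{m \<oplus> x \<otimes> y | m y. m \<in> M \<and> y \<in> carrier R}"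
  have N: "right_ideal ?N R" by (rule right_ideal_principal_sum[OF Mr(1) x(1)])
  have "M \<subseteq> ?N"
  proof
    fix m assume "m \<in> M"
    moreover from this have "m = m \<oplus> x \<otimes> \<zero>" using x by simp
    ultimately show "m \<in> ?N" by blast
  qed
  moreover have "x \<in> ?N"
  proof -
    have "x = \<zero> \<oplus> x \<otimes> \<one>" using x by simp
    then show ?thesis using M.zero_closed by blast
  qed
  ultimately have "?N = carrier R" using M N unfolding maximal_right_ideal_def by blast
  then have "\<one> \<in> ?N" using one_closed by (simp only:)
  then obtain m y where my: "\<one> = m \<oplus> x \<otimes> y" "m \<in> M" "y \<in> carrier R" by blast
  have "m \<in> carrier R" using M.a_subset my(2) by blast
  then have "\<one> \<ominus> x \<otimes> y = m" unfolding my(1) using my(3) x by algebra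
  then have "(\<one> \<ominus> x \<otimes> y) \<otimes> s \<noteq> \<one>" if "s \<in> carrier R" for s
    using right_ideal_one[OF Mr(1)] Mr my(2) that unfolding right_ideal_def by metis
  then show ?thesis using my(3) by blast
qed

text \<open>Absorption from the left is not visible in an intersection of right ideals. It follows
  by moving x around: 1 - (ay)x is a unit, hence so is 1 - x(ay).\<close>

lemma ideal_jacobson_radical: "ideal (jacobson_radical R) R"
proof -
  interpret J: additive_subgroup "jacobson_radical R" R
    using right_ideal_jacobson_radical by (simp add: right_ideal_def)
  have Jr: "\<And>a x. a \<in> jacobson_radical R \<Longrightarrow> x \<in> carrier R \<Longrightarrow> a \<otimes> x \<in> jacobson_radical R"
    using right_ideal_jacobson_radical by (simp add: right_ideal_def)
  have "x \<otimes> a \<in> jacobson_radical R" if a: "a \<in> jacobson_radical R" and x: "x \<in> carrier R" for a x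
  proof (rule ccontr)
    assume no: "x \<otimes> a \<notin> jacobson_radical R"
    have ac: "a \<in> carrier R" using a by (rule jacobson_radical_closed)
    obtain y where y: "y \<in> carrier R" "\<forall>s\<in>carrier R. (\<one> \<ominus> x \<otimes> a \<otimes> y) \<otimes> s \<noteq> \<one>"
      using not_jacobson_no_right_inverse[OF _ no] ac x by auto
    have "\<one> \<ominus> a \<otimes> y \<otimes> x \<in> Units R" by (rule Units_one_minus_jacobson) (use a x y Jr in simp)
    then have "\<one> \<ominus> x \<otimes> (a \<otimes> y) \<in> Units R"
      by (rule Units_one_minus_swap[rotated 2]) (use ac x y in auto)
    then have "\<one> \<ominus> x \<otimes> a \<otimes> y \<in> Units R" using ac x y by (simp add: m_assoc)
    then show False using y(2) Units_r_inv Units_inv_closed by blast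
  qed
  then show ?thesis by (rule idealI[OF ring_axioms J.a_subgroup]) (use Jr in auto)
qed

end

subsection \<open>Rings with unipotent units\<close>

definition unipotent_units :: "('a, 'b) ring_scheme \<Rightarrow> bool" where
  "unipotent_units R \<longleftrightarrow> (\<forall>u\<in>Units R. u \<ominus>\<^bsub>R\<^esub> \<one>\<^bsub>R\<^esub> \<in> nilpotents R)"

context ring
begin

lemma square_zero_nilpotent:
  assumes "x \<in> carrier R" "x \<otimes> x = \<zero>"
  shows "x \<in> nilpotents R"
  by (rule nilpotentsI[of _ 2]) (use assms in \<open>auto simp: numeral_2_eq_2\<close>)

text \<open>
  Relations between products, completed so that they also rewrite inside right-associated words.
\<close>
lemma m_assoc_rule:
  assumes "x \<otimes> y = z" "x \<in> carrier R" "y \<in> carrier R" "w \<in> carrier R"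
  shows "x \<otimes> (y \<otimes> w) = z \<otimes> w"
  using assms m_assoc[of x y w] by simp

lemma m_assoc_rule3:
  assumes "x \<otimes> (y \<otimes> z) = v" "x \<in> carrier R" "y \<in> carrier R" "z \<in> carrier R" "w \<in> carrier R"
  shows "x \<otimes> (y \<otimes> (z \<otimes> w)) = v \<otimes> w"
  using m_assoc[of x "y \<otimes> z" w] assms m_assoc[of y z w] by simp

text \<open>
  Here $xz$, $x$, $z$, $zx$ are matrix units and $1 + n$ with $n = x + z + xz$ is a product of two
  unipotents, but $n (n - 1)$ is the identity of the matrix ring.
\<close>
lemma unipotent_units_square_zero_pair:
  assumes uu: "unipotent_units R" and c: "x \<in> carrier R" "z \<in> carrier R"
    and xx: "x \<otimes> x = \<zero>" and zz: "z \<otimes> z = \<zero>"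
    and xzx: "x \<otimes> (z \<otimes> x) = x" and zxz: "z \<otimes> (x \<otimes> z) = z"
  shows "x = \<zero>"
proof -
  define n where "n = x \<oplus> z \<oplus> x \<otimes> z"
  define h where "h = x \<otimes> z \<oplus> z \<otimes> x"
  have nc: "n \<in> carrier R" and hc: "h \<in> carrier R" using c by (auto simp: n_def h_def)
  note rules = xx zz xzx zxz m_assoc_rule[OF xx c(1,1)] m_assoc_rule[OF zz c(2,2)]
    m_assoc_rule3[OF xzx c(1,2,1)] m_assoc_rule3[OF zxz c(2,1,2)]
  have "(\<one> \<oplus> x) \<otimes> (\<one> \<oplus> z) \<in> Units R"
    using c xx zz by (intro Units_m_closed Units_one_plus_nilpotent square_zero_nilpotent)
  then have "(\<one> \<oplus> x) \<otimes> (\<one> \<oplus> z) \<ominus> \<one> \<in> nilpotents R"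
    using uu by (simp add: unipotent_units_def)
  also have "(\<one> \<oplus> x) \<otimes> (\<one> \<oplus> z) \<ominus> \<one> = n" unfolding n_def using c by algebra
  finally have n: "n \<in> nilpotents R" .
  have nn: "n \<otimes> (n \<ominus> \<one>) = h" and nn': "(n \<ominus> \<one>) \<otimes> n = h"
    unfolding n_def h_def using c rules by algebra+
  have "h \<in> nilpotents R" using nilpotents_mult_commute[OF n, of "n \<ominus> \<one>"] nn nn' nc by simp
  moreover have "h \<otimes> h = h" unfolding h_def using c rules by algebra
  ultimately have "h = \<zero>" by (rule idempotent_nilpotent_zero)
  moreover have "h \<otimes> x = x" unfolding h_def using c rules by algebra
  ultimately show ?thesis using c by simp
qed

text \<open>
  Multiplying $a$ by the unit $w$, which is $1$ modulo $J(R)$, turns $a^2 \in J(R)$ into an exact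
  equation $x^2 = 0$.
\<close>
lemma unipotent_units_regular_square_jacobson:
  assumes uu: "unipotent_units R" and c: "a \<in> carrier R" "r \<in> carrier R"
    and ara: "a \<otimes> (r \<otimes> a) = a" and aa: "a \<otimes> a \<in> jacobson_radical R"
  shows "a = \<zero>"
proof -
  interpret J: ideal "jacobson_radical R" R by (rule ideal_jacobson_radical)
  \<comment> \<open>Passing from r to rar makes the inner inverse reflexive: besides asa = a also
    sas = s holds.\<close>
  define s where "s = r \<otimes> a \<otimes> r"
  have sc: "s \<in> carrier R" using c by (simp add: s_def)
  note rara = ara m_assoc_rule3[OF ara c(1,2,1)]
  have asa: "a \<otimes> (s \<otimes> a) = a" and sas: "s \<otimes> (a \<otimes> s) = s"
    unfolding s_def using c rara by algebra+
  \<comment> \<open>Chosen so that awa = aa - (asa)(asa) = 0.\<close>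
  define w where "w = \<one> \<ominus> s \<otimes> (a \<otimes> a) \<otimes> s"
  have wu: "w \<in> Units R" unfolding w_def
    by (rule Units_one_minus_jacobson[OF J.I_r_closed[OF J.I_l_closed[OF aa sc] sc]])
  define v where "v = inv w"
  have wc: "w \<in> carrier R" and vc: "v \<in> carrier R" and vw: "v \<otimes> w = \<one>"
    using wu by (auto simp: v_def)
  define x where "x = w \<otimes> a"
  define y where "y = s \<otimes> v"
  have xc: "x \<in> carrier R" and yc: "y \<in> carrier R" using c sc wc vc by (auto simp: x_def y_def)
  note vwr = vw m_assoc_rule[OF vw vc wc]
  have yx: "y \<otimes> x = s \<otimes> a" unfolding x_def y_def using c sc vc wc vwr by algebra
  have xyx: "x \<otimes> (y \<otimes> x) = x" unfolding yx unfolding x_def using c sc wc asa by algebra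
  have yxy: "y \<otimes> (x \<otimes> y) = y"
  proof -
    have "y \<otimes> (x \<otimes> y) = (y \<otimes> x) \<otimes> y" using xc yc by (simp add: m_assoc)
    also have "\<dots> = s \<otimes> (a \<otimes> s) \<otimes> v" unfolding yx unfolding y_def using c sc vc by algebra
    finally show ?thesis by (simp add: sas y_def)
  qed
  have "a \<otimes> (w \<otimes> a) = \<zero>"
    unfolding w_def using c sc asa m_assoc_rule3[OF asa c(1) sc c(1)] by algebra
  then have xx: "x \<otimes> x = \<zero>" unfolding x_def using wc c by (simp add: m_assoc)
  note rules = xyx yxy xx m_assoc_rule[OF xx xc xc] m_assoc_rule3[OF xyx xc yc xc] m_assoc_rule3[OF yxy yc xc yc]
  \<comment> \<open>This is z = y(1 - yx). Since yxy = y gives (1 - yx)y = 0, the square of z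
    vanishes; since xx = 0, still zx = yx, so the relations with x survive.\<close>
  define z where "z = y \<ominus> y \<otimes> (y \<otimes> x)"
  have zc: "z \<in> carrier R" using xc yc by (simp add: z_def)
  have "z \<otimes> z = \<zero>" "x \<otimes> (z \<otimes> x) = x" "z \<otimes> (x \<otimes> z) = z"
    unfolding z_def using xc yc rules by algebra+
  then have "x = \<zero>" using unipotent_units_square_zero_pair[OF uu xc zc xx] by simp
  then have "v \<otimes> (w \<otimes> a) = \<zero>" using vc by (simp add: x_def)
  then show ?thesis using c vwr by simp
qed


section \<open>The exchange condition in terms of elements\<close>

lemma exchange_ringE:
  assumes "exchange_ring R" "a \<in> carrier R"
  obtains e r s where "e \<in> carrier R" "e \<otimes> e = e" "r \<in> carrier R" "s \<in> carrier R"
    "a \<otimes> r = e" "(\<one> \<ominus> a) \<otimes> s = \<one> \<ominus> e"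
proof -
  obtain e where e: "e \<in> idempotents R" "e \<in> a <# carrier R" "\<one> \<ominus> e \<in> (\<one> \<ominus> a) <# carrier R"
    using assms unfolding exchange_ring_def by blast
  obtain r where "r \<in> carrier R" "a \<otimes> r = e" using e(2) by (auto simp: l_coset_def)
  moreover obtain s where "s \<in> carrier R" "(\<one> \<ominus> a) \<otimes> s = \<one> \<ominus> e"
    using e(3) by (auto simp: l_coset_def)
  ultimately show thesis using that e(1) by (auto simp: idempotents_def)
qed

lemma exchange_ringI:
  assumes "\<And>a. a \<in> carrier R \<Longrightarrow> \<exists>e\<in>carrier R. \<exists>r\<in>carrier R. \<exists>s\<in>carrier R.
    e \<otimes> e = e \<and> a \<otimes> r = e \<and> (\<one> \<ominus> a) \<otimes> s = \<one> \<ominus> e"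
  shows "exchange_ring R"
  unfolding exchange_ring_def
proof
  fix a assume "a \<in> carrier R"
  then obtain e r s where e: "e \<in> carrier R" "r \<in> carrier R" "s \<in> carrier R" "e \<otimes> e = e"
    "a \<otimes> r = e" "(\<one> \<ominus> a) \<otimes> s = \<one> \<ominus> e" using assms by metis
  then have "e \<in> idempotents R" "e \<in> a <# carrier R" "\<one> \<ominus> e \<in> (\<one> \<ominus> a) <# carrier R"
    unfolding idempotents_def l_coset_def by blast+
  then show "\<exists>e\<in>idempotents R. e \<in> a <# carrier R \<and> \<one> \<ominus> e \<in> (\<one> \<ominus> a) <# carrier R" by blast
qed

end

subsection \<open>Exchange rings with unipotent units\<close>

locale exchange_unipotent = ring +
  assumes exch: "exchange_ring R" and uu: "unipotent_units R"
begin

lemma square_jacobson_imp_jacobson: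
  assumes a: "a \<in> carrier R" and aa: "a \<otimes> a \<in> jacobson_radical R"
  shows "a \<in> jacobson_radical R"
proof (rule ccontr)
  interpret J: ideal "jacobson_radical R" R by (rule ideal_jacobson_radical)
  assume "a \<notin> jacobson_radical R"
  then obtain y where y: "y \<in> carrier R" "\<And>s. s \<in> carrier R \<Longrightarrow> (\<one> \<ominus> a \<otimes> y) \<otimes> s \<noteq> \<one>"
    using not_jacobson_no_right_inverse[OF a] by blast
  obtain e r s where e: "e \<in> carrier R" "e \<otimes> e = e" "r \<in> carrier R" "s \<in> carrier R"
    "a \<otimes> y \<otimes> r = e" "(\<one> \<ominus> a \<otimes> y) \<otimes> s = \<one> \<ominus> e"
    by (rule exchange_ringE[OF exch m_closed[OF a y(1)]])
  have yr: "a \<otimes> (y \<otimes> r) = e" using e a y by (simp add: m_assoc)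
  have eyr: "y \<otimes> r \<in> carrier R" using y e by simp
  \<comment> \<open>The element \<open>a\<close> may fail to be regular, but
    \<open>e \<otimes> a\<close> has the inner inverse \<open>y \<otimes> r\<close>, as e = ayr. The
    same equation puts its square in the radical: eaea = e(aa)(yra).\<close>
  have "e \<otimes> a = \<zero>"
  proof (rule unipotent_units_regular_square_jacobson[OF uu])
    show "e \<otimes> a \<in> carrier R" "y \<otimes> r \<in> carrier R" using e a y by auto
    have "e \<otimes> a \<otimes> (y \<otimes> r \<otimes> (e \<otimes> a)) = e \<otimes> (a \<otimes> (y \<otimes> r)) \<otimes> e \<otimes> a"
      using e(1,3) a y(1) by algebra
    then show "e \<otimes> a \<otimes> (y \<otimes> r \<otimes> (e \<otimes> a)) = e \<otimes> a" using yr e(2) by simp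
    have "e \<otimes> a \<otimes> (e \<otimes> a) = e \<otimes> (a \<otimes> a) \<otimes> (y \<otimes> r \<otimes> a)"
      unfolding yr[symmetric] using a eyr by algebra
    then show "e \<otimes> a \<otimes> (e \<otimes> a) \<in> jacobson_radical R"
      using J.I_r_closed[OF J.I_l_closed[OF aa e(1)]] eyr a by simp
  qed
  then have "e \<otimes> (a \<otimes> (y \<otimes> r)) = \<zero>" using a e(1) eyr by (simp add: m_assoc[symmetric])
  then have "e = \<zero>" using yr e(2) by simp
  then have "(\<one> \<ominus> a \<otimes> y) \<otimes> s = \<one>" using e(6) by (simp add: minus_eq)
  then show False using y(2) e(4) by blast
qed

text \<open>The exponent drops by one each time: the square of a^(n+1) is a multiple of a^(n+2), so
  the criterion for squares applies to a^(n+1).\<close>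

lemma power_jacobson_imp_jacobson:
  assumes a: "a \<in> carrier R"
  shows "a [^] Suc n \<in> jacobson_radical R \<Longrightarrow> a \<in> jacobson_radical R"
proof (induction n)
  case 0
  then show ?case using a by simp
next
  case (Suc n)
  interpret J: ideal "jacobson_radical R" R by (rule ideal_jacobson_radical)
  have "a [^] Suc n \<otimes> a [^] Suc n = a [^] Suc (Suc n) \<otimes> a [^] n"
    using a by (simp only: nat_pow_mult) simp
  also have "\<dots> \<in> jacobson_radical R" using J.I_r_closed[OF Suc.prems] a by simp
  finally have "a [^] Suc n \<in> jacobson_radical R"
    by (rule square_jacobson_imp_jacobson[rotated]) (use a in simp)
  then show ?case by (rule Suc.IH)
qed

lemma nilpotent_imp_jacobson:
  assumes "q \<in> nilpotents R"
  shows "q \<in> jacobson_radical R"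
proof -
  interpret J: ideal "jacobson_radical R" R by (rule ideal_jacobson_radical)
  obtain n :: nat where n: "q \<in> carrier R" "q [^] n = \<zero>" using assms by (auto simp: nilpotents_def)
  then have "q [^] Suc n \<in> jacobson_radical R" by (simp add: J.zero_closed)
  then show ?thesis using power_jacobson_imp_jacobson n(1) by blast
qed

text \<open>From uv = 1 one gets (1 - vu)v = 0, so v(1 - vu) has square zero and lies in J(R).
  Multiplication by u on the left puts 1 - vu in J(R); then vu is an idempotent unit, that is,
  1.\<close>

lemma right_invertible_Units:
  assumes c: "u \<in> carrier R" "v \<in> carrier R" and uv: "u \<otimes> v = \<one>"
  shows "u \<in> Units R"
proof -
  interpret J: ideal "jacobson_radical R" R by (rule ideal_jacobson_radical)
  let ?g = "\<one> \<ominus> v \<otimes> u"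
  note rules = uv m_assoc_rule[OF uv c]
  have "(v \<otimes> ?g) \<otimes> (v \<otimes> ?g) = \<zero>" using c rules by algebra
  then have "v \<otimes> ?g \<in> jacobson_radical R"
    using nilpotent_imp_jacobson square_zero_nilpotent c by simp
  then have "u \<otimes> (v \<otimes> ?g) \<in> jacobson_radical R" by (rule J.I_l_closed[OF _ c(1)])
  also have "u \<otimes> (v \<otimes> ?g) = ?g" using c rules by algebra
  finally have "\<one> \<ominus> ?g \<in> Units R" by (rule Units_one_minus_jacobson)
  also have "\<one> \<ominus> ?g = v \<otimes> u" using c by algebra
  finally have "v \<otimes> u = \<one>" by (rule idempotent_unit_one) (use c rules in algebra)
  then show ?thesis using Units_two_sided[of u v v] c uv by simp
qed

lemma minus_square_jacobson:
  assumes a: "a \<in> carrier R"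
  shows "a \<ominus> a \<otimes> a \<in> jacobson_radical R"
proof -
  interpret J: ideal "jacobson_radical R" R by (rule ideal_jacobson_radical)
  obtain e r s where e: "e \<in> carrier R" "e \<otimes> e = e" "r \<in> carrier R" "s \<in> carrier R"
    "a \<otimes> r = e" "(\<one> \<ominus> a) \<otimes> s = \<one> \<ominus> e"
    by (rule exchange_ringE[OF exch a])
  have as: "a \<otimes> s = s \<ominus> (\<one> \<ominus> e)" unfolding e(6)[symmetric] using a e(4) by algebra
  let ?f = "\<one> \<ominus> e"
  define u where "u = a \<ominus> ?f"
  \<comment> \<open>The off-diagonal Peirce corners of s and r with respect to e. Each has square
    zero and hence lies in J(R), which as an ideal also contains their sum.\<close>
  define j where "j = e \<otimes> s \<otimes> ?f \<oplus> ?f \<otimes> r \<otimes> e"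
  have uc: "u \<in> carrier R" using a e by (simp add: u_def)
  note ee = e(2) m_assoc_rule[OF e(2) e(1,1)]
  have "e \<otimes> s \<otimes> ?f \<otimes> (e \<otimes> s \<otimes> ?f) = \<zero>" "?f \<otimes> r \<otimes> e \<otimes> (?f \<otimes> r \<otimes> e) = \<zero>"
    using e(1,3,4) ee by algebra+
  then have "e \<otimes> s \<otimes> ?f \<in> jacobson_radical R" "?f \<otimes> r \<otimes> e \<in> jacobson_radical R"
    using nilpotent_imp_jacobson square_zero_nilpotent e(1,3,4) by simp_all
  then have "\<one> \<ominus> j \<in> Units R" 
    unfolding j_def by (intro Units_one_minus_jacobson) (rule J.a_closed)
  then obtain w where w: "w \<in> carrier R" "(\<one> \<ominus> j) \<otimes> w = \<one>"
    using Units_r_inv[of "\<one> \<ominus> j"] Units_inv_closed[of "\<one> \<ominus> j"] by blast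
  \<comment> \<open>The candidate for a right inverse uses r on the part of e and s on the part of 1
    - e, because ar = e and (1 - a)s = 1 - e; the mixed terms are what remains as j.\<close>
  have "u \<otimes> (r \<otimes> e \<ominus> s \<otimes> ?f)
      = (a \<otimes> r) \<otimes> e \<ominus> (a \<otimes> s) \<otimes> ?f \<ominus> ?f \<otimes> r \<otimes> e \<oplus> ?f \<otimes> s \<otimes> ?f"
    unfolding u_def using a e(1,3,4) by algebra
  also have "\<dots> = \<one> \<ominus> j" unfolding e(5) as j_def using e(1,3,4) ee by algebra
  finally have "u \<otimes> (r \<otimes> e \<ominus> s \<otimes> ?f) = \<one> \<ominus> j" .
  then have ub: "u \<otimes> ((r \<otimes> e \<ominus> s \<otimes> ?f) \<otimes> w) = \<one>"
    using m_assoc[of u "r \<otimes> e \<ominus> s \<otimes> ?f" w] w uc e(1,3,4) by simp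
  have "u \<in> Units R" by (rule right_invertible_Units[OF uc _ ub]) (use w(1) e(1,3,4) in simp)
  then have m: "u \<ominus> \<one> \<in> jacobson_radical R" using uu nilpotent_imp_jacobson by (simp add: unipotent_units_def)
  have "\<ominus> \<one> \<ominus> \<one> \<in> nilpotents R"
    using uu Units_minus_one_closed by (simp add: unipotent_units_def)
  then have two: "\<ominus> \<one> \<ominus> \<one> \<in> jacobson_radical R" by (rule nilpotent_imp_jacobson)
  \<comment> \<open>This is u - 1 + 2 = a + e, so \<open>a\<close> is congruent to -e, and a - aa to
    -2e, which is again in J(R).\<close>
  define t where "t = (u \<ominus> \<one>) \<ominus> (\<ominus> \<one> \<ominus> \<one>)"
  have tJ: "t \<in> jacobson_radical R" unfolding t_def using m two by (simp only: minus_eq J.a_closed J.a_inv_closed)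
  then have tc: "t \<in> carrier R" by (rule jacobson_radical_closed)
  have a_eq: "a = t \<ominus> e" unfolding t_def u_def using a e(1) by algebra
  have "a \<ominus> a \<otimes> a = t \<ominus> t \<otimes> t \<oplus> t \<otimes> e \<oplus> e \<otimes> t \<oplus> (\<ominus> \<one> \<ominus> \<one>) \<otimes> e"
    unfolding a_eq using tc e(1) ee by algebra
  also have "\<dots> \<in> jacobson_radical R"
    unfolding minus_eq
    by (intro J.a_closed J.a_inv_closed tJ J.I_r_closed[OF tJ tc] J.I_r_closed[OF tJ e(1)]
        J.I_l_closed[OF tJ e(1)] J.I_r_closed[OF two[unfolded minus_eq] e(1)])
  finally show ?thesis .
qed

end

subsection \<open>Lifting idempotents\<close>

text \<open>
  Newton step: $a' = a^2 (1 + 2b)$ and $b' = b^2 (1 + 2a)$ again have sum $1$, and $(ab)^2$ divides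
  $a' b'$.
\<close>
lemma (in cring) newton_idempotent:
  assumes "a \<in> carrier R" "b \<in> carrier R" "a \<oplus> b = \<one>" "(a \<otimes> b) [^] (n::nat) = \<zero>"
  shows "\<exists>e\<in>carrier R. \<exists>f\<in>carrier R. \<exists>r\<in>carrier R. \<exists>s\<in>carrier R. \<exists>t\<in>carrier R.
    e \<otimes> e = e \<and> e \<oplus> f = \<one> \<and> a \<otimes> r = e \<and> b \<otimes> s = f \<and> a = e \<oplus> a \<otimes> b \<otimes> t"
  using assms
proof (induction n arbitrary: a b rule: less_induct)
  case (less n)
  note c = less.prems(1,2) and ab = less.prems(3) and nil = less.prems(4)
  show ?case
  proof (cases "a \<otimes> b = \<zero>")
    case True
    have "a \<otimes> a = a \<otimes> (a \<oplus> b) \<ominus> a \<otimes> b" using c by algebra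
    also have "\<dots> = a" using True ab c by (simp add: minus_eq)
    finally show ?thesis using True ab c
      by (intro bexI[of _ a] bexI[of _ b] bexI[of _ \<one>] bexI[of _ \<zero>]) auto
  next
    case False
    have "n \<ge> 2"
    proof (rule ccontr)
      assume "\<not> n \<ge> 2"
      then consider "n = 0" | "n = 1" by linarith
      then have "a \<otimes> b = \<zero>"
      proof cases
        case 1
        then have "carrier R = {\<zero>}" using nil one_zeroD by simp
        then show ?thesis using c by auto
      qed (use nil c in simp)
      then show False using False by simp
    qed
    \<comment> \<open>Exponent n - 1 suffices: the power n - 1 of a multiple of (ab)^2 contains
      (ab)^(2n-2), and 2n - 2 = n + (n - 2) with n at least 2.\<close>
    define m where "m = n - 1"
    have m: "m < n" "m + m = n + (n - 2)" using \<open>n \<ge> 2\<close> by (auto simp: m_def)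
    \<comment> \<open>With b = 1 - a this is 3a^2 - 2a^3, the polynomial with values 0 and 1 at 0
      and 1 and vanishing derivative at both points.\<close>
    define a' where "a' = a \<otimes> (a \<otimes> (\<one> \<oplus> b \<oplus> b))"
    define b' where "b' = b \<otimes> (b \<otimes> (\<one> \<oplus> a \<oplus> a))"
    define k where "k = (\<one> \<oplus> b \<oplus> b) \<otimes> (\<one> \<oplus> a \<oplus> a)"
    define d where "d = a \<otimes> b"
    have c': "a' \<in> carrier R" "b' \<in> carrier R" "k \<in> carrier R" "d \<in> carrier R"
      using c by (auto simp: a'_def b'_def k_def d_def)
    have "a' \<oplus> b' = (a \<oplus> b) \<otimes> (a \<oplus> b) \<oplus> a \<otimes> b \<otimes> (a \<oplus> b) \<oplus> a \<otimes> b \<otimes> (a \<oplus> b)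
        \<ominus> a \<otimes> b \<ominus> a \<otimes> b"
      unfolding a'_def b'_def using c by algebra
    also have "\<dots> = \<one> \<oplus> d \<oplus> d \<ominus> d \<ominus> d" unfolding ab using c by (simp add: d_def)
    also have "\<dots> = \<one>" using c'(4) by algebra
    finally have ab': "a' \<oplus> b' = \<one>" .
    have prod: "a' \<otimes> b' = d \<otimes> (d \<otimes> k)"
      unfolding a'_def b'_def d_def k_def using c by (simp add: m_ac)
    have "(a' \<otimes> b') [^] m = d [^] m \<otimes> d [^] m \<otimes> k [^] m"
      unfolding prod using c' by (simp add: pow_mult_distrib m_comm m_ac)
    also have "d [^] m \<otimes> d [^] m = d [^] n \<otimes> d [^] (n - 2)"
      using c'(4) m(2) by (simp add: nat_pow_mult)
    also have "\<dots> = \<zero>" using nil c'(4) by (simp add: d_def)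
    finally have "(a' \<otimes> b') [^] m = \<zero>" using c' by simp
    then obtain e f r s t where e: "e \<in> carrier R" "f \<in> carrier R" "r \<in> carrier R" "s \<in> carrier R"
      "t \<in> carrier R" "e \<otimes> e = e" "e \<oplus> f = \<one>" "a' \<otimes> r = e" "b' \<otimes> s = f" "a' = e \<oplus> a' \<otimes> b' \<otimes> t"
      using less.IH[OF m(1) c'(1,2) ab'] by metis
    have 1: "a \<otimes> (a \<otimes> (\<one> \<oplus> b \<oplus> b) \<otimes> r) = e" "b \<otimes> (b \<otimes> (\<one> \<oplus> a \<oplus> a) \<otimes> s) = f"
      using e(3,4,8,9) c by (simp_all add: a'_def b'_def m_assoc)
    \<comment> \<open>The error of one step is a multiple of ab: a(a + b) - a^2(1 + 2b) = ab(1 -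
      2a).\<close>
    have "a = a' \<oplus> (a \<otimes> (a \<oplus> b) \<ominus> a')" unfolding ab using c c' by algebra
    also have "a \<otimes> (a \<oplus> b) \<ominus> a' = a \<otimes> b \<otimes> (\<one> \<ominus> a \<ominus> a)"
      unfolding a'_def using c by algebra
    also have "a' \<oplus> \<dots> = e \<oplus> (d \<otimes> (d \<otimes> k) \<otimes> t \<oplus> d \<otimes> (\<one> \<ominus> a \<ominus> a))"
      using e(10) e(1,5) c c' unfolding prod d_def[symmetric] by (simp add: a_assoc)
    also have "\<dots> = e \<oplus> d \<otimes> (d \<otimes> k \<otimes> t \<oplus> (\<one> \<ominus> a \<ominus> a))"
      using e(1,5) c c' by algebra
    finally have 2: "a = e \<oplus> a \<otimes> b \<otimes> (d \<otimes> k \<otimes> t \<oplus> (\<one> \<ominus> a \<ominus> a))"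
      by (simp add: d_def)
    show ?thesis
      by (intro bexI[of _ e] bexI[of _ f] bexI[of _ "a \<otimes> (\<one> \<oplus> b \<oplus> b) \<otimes> r"]
          bexI[of _ "b \<otimes> (\<one> \<oplus> a \<oplus> a) \<otimes> s"]
          bexI[of _ "d \<otimes> k \<otimes> t \<oplus> (\<one> \<ominus> a \<ominus> a)"] conjI e(6,7) 1 2)
        (use e(1-5) c c' in simp_all)
  qed
qed

context ring
begin

text \<open>\<open>K\<close> is the double centralizer of \<open>a\<close>, a substitute for the
  subring generated by \<open>a\<close>: it lets a result on commutative rings be applied inside R.
  Its elements commute with one another because each of them commutes with \<open>a\<close>, and
  therefore with everything in \<open>K\<close>.\<close>

lemma bicommutant_cring:
  assumes a: "a \<in> carrier R"
  defines "K \<equiv> {x \<in> carrier R. \<forall>c\<in>carrier R. c \<otimes> a = a \<otimes> c \<longrightarrow> c \<otimes> x = x \<otimes> c}"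
  shows "cring (R\<lparr>carrier := K\<rparr>)" "\<And>x y. x \<in> K \<Longrightarrow> y \<in> K \<Longrightarrow> x \<otimes> y = y \<otimes> x"
    "K \<subseteq> carrier R" "a \<in> K" "\<one> \<ominus> a \<in> K"
proof -
  have memI: "x \<in> K"
    if "x \<in> carrier R" "\<And>c. c \<in> carrier R \<Longrightarrow> c \<otimes> a = a \<otimes> c \<Longrightarrow> c \<otimes> x = x \<otimes> c" for x
    using that by (simp add: K_def)
  have memD: "x \<in> carrier R" "\<And>c. c \<in> carrier R \<Longrightarrow> c \<otimes> a = a \<otimes> c \<Longrightarrow> c \<otimes> x = x \<otimes> c"
    if "x \<in> K" for x
    using that unfolding K_def by blast+
  show sub: "K \<subseteq> carrier R" using memD(1) by blast
  show aK: "a \<in> K" by (rule memI[OF a])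
  show comm: "x \<otimes> y = y \<otimes> x" if "x \<in> K" "y \<in> K" for x y
    by (rule memD(2)[OF that(2) memD(1)[OF that(1)]])
      (rule memD(2)[OF that(1) a refl, symmetric])
  have sub': "subring K R"
  proof (rule subringI[OF sub])
    show "\<one> \<in> K" by (rule memI) auto
    show "\<ominus> x \<in> K" if x: "x \<in> K" for x
    proof (rule memI)
      fix z assume z: "z \<in> carrier R" "z \<otimes> a = a \<otimes> z"
      show "z \<otimes> \<ominus> x = \<ominus> x \<otimes> z"
        using memD(2)[OF x z] memD(1)[OF x] z(1) by (simp only: l_minus r_minus)
    qed (use memD(1)[OF x] in simp)
    show "x \<oplus> y \<in> K" if xy: "x \<in> K" "y \<in> K" for x y
    proof (rule memI)
      fix z assume z: "z \<in> carrier R" "z \<otimes> a = a \<otimes> z"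
      show "z \<otimes> (x \<oplus> y) = (x \<oplus> y) \<otimes> z"
        using memD(2)[OF xy(1) z] memD(2)[OF xy(2) z] memD(1)[OF xy(1)] memD(1)[OF xy(2)] z(1)
        by (simp only: l_distr r_distr)
    qed (use memD(1) xy in simp)
    show "x \<otimes> y \<in> K" if xy: "x \<in> K" "y \<in> K" for x y
    proof (rule memI)
      note c = memD(1)[OF xy(1)] memD(1)[OF xy(2)]
      then show "x \<otimes> y \<in> carrier R" by simp
      fix z assume z: "z \<in> carrier R" "z \<otimes> a = a \<otimes> z"
      have "z \<otimes> (x \<otimes> y) = (x \<otimes> z) \<otimes> y"
        using m_assoc[of z x y] c z(1) by (simp only: memD(2)[OF xy(1) z, symmetric])
      also have "\<dots> = x \<otimes> (y \<otimes> z)"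
        using m_assoc[of x z y] c z(1) by (simp only: memD(2)[OF xy(2) z])
      also have "\<dots> = x \<otimes> y \<otimes> z" using c z(1) by (simp only: m_assoc)
      finally show "z \<otimes> (x \<otimes> y) = x \<otimes> y \<otimes> z" .
    qed
  qed
  show "\<one> \<ominus> a \<in> K"
    unfolding minus_eq using subringE(3,5,7)[OF sub'] aK by blast
  have "subcring K R" by (rule subcringI[OF sub']) (rule comm)
  then show "cring (R\<lparr>carrier := K\<rparr>)" using subcring_iff[OF sub] by simp
qed

text \<open>The Newton iteration, run in the double centralizer, yields one idempotent for three
  uses: \<open>a \<ominus> e\<close> nilpotent with ae = ea is a strongly nil-clean decomposition,
  \<open>r\<close> and \<open>s\<close> witness the exchange condition, and modulo a radical
  containing the nilpotents \<open>e\<close> lifts the class of \<open>a\<close>. The difference a -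
  e equals (a - aa)t with commuting factors, hence is nilpotent.\<close>

lemma lift_idempotent:
  assumes a: "a \<in> carrier R" and nil: "a \<ominus> a \<otimes> a \<in> nilpotents R"
  obtains e r s where "e \<in> carrier R" "r \<in> carrier R" "s \<in> carrier R" "e \<otimes> e = e"
    "a \<otimes> r = e" "(\<one> \<ominus> a) \<otimes> s = \<one> \<ominus> e" "a \<ominus> e \<in> nilpotents R" "a \<otimes> e = e \<otimes> a"
proof -
  define K where "K = {x \<in> carrier R. \<forall>c\<in>carrier R. c \<otimes> a = a \<otimes> c \<longrightarrow> c \<otimes> x = x \<otimes> c}"
  note K = bicommutant_cring[OF a, folded K_def]
  interpret K: cring "R\<lparr>carrier := K\<rparr>" by (rule K(1))
  let ?b = "\<one> \<ominus> a"
  have d: "a \<otimes> ?b = a \<ominus> a \<otimes> a" using a by algebra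
  obtain n :: nat where "(a \<otimes> ?b) [^] n = \<zero>" using nil unfolding d nilpotents_def by blast
  then have n: "(a \<otimes> ?b) [^]\<^bsub>R\<lparr>carrier := K\<rparr>\<^esub> n = \<zero>" by (simp only: nat_pow_consistent[symmetric])
  have ab: "a \<oplus> ?b = \<one>" using a by algebra
  obtain e f r s t where e: "e \<in> K" "f \<in> K" "r \<in> K" "s \<in> K" "t \<in> K"
      "e \<otimes> e = e" "e \<oplus> f = \<one>" "a \<otimes> r = e" "?b \<otimes> s = f" "a = e \<oplus> a \<otimes> ?b \<otimes> t"
    using K.newton_idempotent[of a ?b n] K(4,5) ab n by auto
  have c: "e \<in> carrier R" "f \<in> carrier R" "r \<in> carrier R" "s \<in> carrier R" "t \<in> carrier R"
    using e(1-5) K(3) by auto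
  have "f = (e \<oplus> f) \<ominus> e" using c by algebra
  then have f: "f = \<one> \<ominus> e" using e(7) by simp
  let ?d = "a \<otimes> ?b"
  have dc: "?d \<in> carrier R" using a by simp
  have "?d \<otimes> t = t \<otimes> ?d" using K.m_comm[of ?d t] K.m_closed[of a ?b] K(4,5) e(5) by simp
  then have "?d \<otimes> t \<in> nilpotents R" using nilpotents_mult_commute[of ?d t] nil d c by simp
  also have "?d \<otimes> t = (e \<oplus> ?d \<otimes> t) \<ominus> e" using dc c by algebra
  also have "\<dots> = a \<ominus> e" using e(10) by simp
  finally have "a \<ominus> e \<in> nilpotents R" .
  then show thesis using that[OF c(1,3,4) e(6,8)] e(9) f K(2)[OF K(4) e(1)] by simp
qed


subsection \<open>The equivalences\<close>

text \<open>For the converse, nilness of the radical is recovered before the coset equation: if x is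
  in J(R), then 1 + x is a unit, so x is nilpotent. Only then may \<open>jacobson_sharp R\<close> be
  replaced by the nilpotents.\<close>

lemma UJ_sharp_iff_unipotent_units:
  "UJ_sharp R \<and> nil_subset (jacobson_radical R) R \<longleftrightarrow> unipotent_units R"
proof -
  interpret J: ideal "jacobson_radical R" R by (rule ideal_jacobson_radical)
  have sharp: "jacobson_sharp R = nilpotents R" if nil: "nil_subset (jacobson_radical R) R"
  proof (intro equalityI subsetI)
    fix z assume "z \<in> jacobson_sharp R"
    then obtain n :: nat where z: "z \<in> carrier R" "z [^] n \<in> jacobson_radical R"
      unfolding jacobson_sharp_def by blast
    then have "z [^] n \<in> nilpotents R" using nil by (auto simp: nil_subset_def)
    then obtain m :: nat where "(z [^] n) [^] m = \<zero>" unfolding nilpotents_def by blast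
    then show "z \<in> nilpotents R" using z(1) nilpotentsI[of z "n * m"] by (simp add: nat_pow_pow)
  next
    fix z assume "z \<in> nilpotents R"
    then obtain n :: nat where "z \<in> carrier R" "n \<ge> 1" "z [^] n = \<zero>" unfolding nilpotents_def by blast
    then show "z \<in> jacobson_sharp R"
      unfolding jacobson_sharp_def using J.zero_closed by (auto intro!: exI[of _ n])
  qed
  show ?thesis
  proof
    assume l: "UJ_sharp R \<and> nil_subset (jacobson_radical R) R"
    then have U: "Units R = \<one> <+ nilpotents R" using sharp by (simp add: UJ_sharp_def)
    show "unipotent_units R" unfolding unipotent_units_def
    proof
      fix u assume "u \<in> Units R"
      then obtain q where q: "q \<in> nilpotents R" "u = \<one> \<oplus> q"
        unfolding U a_l_coset_def' by blast
      have "q \<in> carrier R" using q(1) by (rule nilpotents_closed)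
      then have "u \<ominus> \<one> = q" unfolding q(2) by algebra
      then show "u \<ominus> \<one> \<in> nilpotents R" using q(1) by simp
    qed
  next
    assume uu: "unipotent_units R"
    have "x \<in> nilpotents R" if x: "x \<in> jacobson_radical R" for x
    proof -
      have xc: "x \<in> carrier R" using x by (rule jacobson_radical_closed)
      have "\<one> \<ominus> \<ominus> x \<in> Units R" using Units_one_minus_jacobson J.a_inv_closed[OF x] by blast
      then have "\<one> \<ominus> \<ominus> x \<ominus> \<one> \<in> nilpotents R" using uu by (simp add: unipotent_units_def)
      also have "\<one> \<ominus> \<ominus> x \<ominus> \<one> = x" using xc by algebra
      finally show ?thesis .
    qed
    then have nil: "nil_subset (jacobson_radical R) R" by (auto simp: nil_subset_def)
    moreover have "Units R = \<one> <+ nilpotents R"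
    proof (intro equalityI subsetI)
      fix u assume u: "u \<in> Units R"
      have "u \<in> carrier R" using u by (rule Units_closed)
      then have "u = \<one> \<oplus> (u \<ominus> \<one>)" by algebra
      moreover have "u \<ominus> \<one> \<in> nilpotents R" using uu u by (simp add: unipotent_units_def)
      ultimately show "u \<in> \<one> <+ nilpotents R" unfolding a_l_coset_def' by blast
    next
      fix u assume "u \<in> \<one> <+ nilpotents R"
      then show "u \<in> Units R" unfolding a_l_coset_def' using Units_one_plus_nilpotent by blast
    qed
    ultimately show "UJ_sharp R \<and> nil_subset (jacobson_radical R) R"
      using sharp by (simp add: UJ_sharp_def)
  qed
qed

section \<open>Strongly nil-clean rings and the nilpotency of a - a^2\<close>

lemma strongly_nil_cleanE:
  assumes "strongly_nil_clean R" "a \<in> carrier R"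
  obtains e q where "e \<in> carrier R" "e \<otimes> e = e" "q \<in> nilpotents R" "a = e \<oplus> q" "e \<otimes> q = q \<otimes> e"
  using assms unfolding strongly_nil_clean_def idempotents_def by blast

text \<open>The factorization a - aa = q(1 - 2e - q) has commuting factors, the first of them
  nilpotent. Together with \<open>minus_square_nilpotent_strongly_nil_clean\<close> it frees strong
  nil-cleanness from the choice of a decomposition.\<close>

lemma strongly_nil_clean_minus_square:
  assumes snc: "strongly_nil_clean R" and a: "a \<in> carrier R"
  shows "a \<ominus> a \<otimes> a \<in> nilpotents R"
proof -
  obtain e q where e: "e \<in> carrier R" "e \<otimes> e = e" "q \<in> nilpotents R" "a = e \<oplus> q" "e \<otimes> q = q \<otimes> e"
    by (rule strongly_nil_cleanE[OF snc a])
  have qc: "q \<in> carrier R" using e(3) by (rule nilpotents_closed)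
  note rules = e(2,5) m_assoc_rule[OF e(2) e(1,1)] m_assoc_rule[OF e(5) e(1) qc]
  let ?t = "\<one> \<ominus> e \<ominus> e \<ominus> q"
  have "q \<otimes> ?t = ?t \<otimes> q" using e(1) qc rules by algebra
  then have "q \<otimes> ?t \<in> nilpotents R" using nilpotents_mult_commute[OF e(3), of ?t] e(1) qc by simp
  also have "q \<otimes> ?t = a \<ominus> a \<otimes> a" unfolding e(4) using e(1) qc rules by algebra
  finally show ?thesis .
qed

lemma minus_square_nilpotent_strongly_nil_clean:
  assumes "\<And>a. a \<in> carrier R \<Longrightarrow> a \<ominus> a \<otimes> a \<in> nilpotents R"
  shows "strongly_nil_clean R"
  unfolding strongly_nil_clean_def
proof
  fix a assume a: "a \<in> carrier R"
  obtain e r s where e: "e \<in> carrier R" "r \<in> carrier R" "s \<in> carrier R" "e \<otimes> e = e"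
    "a \<otimes> r = e" "(\<one> \<ominus> a) \<otimes> s = \<one> \<ominus> e" "a \<ominus> e \<in> nilpotents R" "a \<otimes> e = e \<otimes> a"
    by (rule lift_idempotent[OF a assms[OF a]])
  have "a = e \<oplus> (a \<ominus> e)" using a e(1) by algebra
  moreover have "e \<otimes> (a \<ominus> e) = (a \<ominus> e) \<otimes> e"
    using a e(1) e(8)[symmetric] by (simp only: minus_eq l_distr r_distr l_minus r_minus a_inv_closed)
  moreover have "e \<in> idempotents R" using e(1,4) by (simp add: idempotents_def)
  ultimately show "\<exists>e\<in>idempotents R. \<exists>q\<in>nilpotents R. a = e \<oplus> q \<and> e \<otimes> q = q \<otimes> e"
    using e(7) by blast
qed

lemma strongly_nil_clean_exchange:
  assumes snc: "strongly_nil_clean R"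
  shows "exchange_ring R"
proof (rule exchange_ringI)
  fix a assume a: "a \<in> carrier R"
  obtain e r s where "e \<in> carrier R" "r \<in> carrier R" "s \<in> carrier R" "e \<otimes> e = e"
    "a \<otimes> r = e" "(\<one> \<ominus> a) \<otimes> s = \<one> \<ominus> e"
    by (rule lift_idempotent[OF a strongly_nil_clean_minus_square[OF snc a]])
  then show "\<exists>e\<in>carrier R. \<exists>r\<in>carrier R. \<exists>s\<in>carrier R.
      e \<otimes> e = e \<and> a \<otimes> r = e \<and> (\<one> \<ominus> a) \<otimes> s = \<one> \<ominus> e" by blast
qed

text \<open>On the complement h = 1 - e the unit acts as q, since eh = 0 gives uh = qh. Thus h is
  the product of the nilpotent qh and the inverse of u, which commute; a nilpotent idempotent is 0,
  so e = 1 and u - 1 = q.\<close>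

lemma strongly_nil_clean_unipotent_units:
  assumes snc: "strongly_nil_clean R"
  shows "unipotent_units R"
  unfolding unipotent_units_def
proof
  fix u assume u: "u \<in> Units R"
  have uc: "u \<in> carrier R" using u by (rule Units_closed)
  obtain e q where e: "e \<in> carrier R" "e \<otimes> e = e" "q \<in> nilpotents R" "u = e \<oplus> q" "e \<otimes> q = q \<otimes> e"
    by (rule strongly_nil_cleanE[OF snc uc])
  have qc: "q \<in> carrier R" using e(3) by (rule nilpotents_closed)
  note rules = e(2,5) m_assoc_rule[OF e(2) e(1,1)] m_assoc_rule[OF e(5) e(1) qc]
  define h where "h = \<one> \<ominus> e"
  define v where "v = inv u"
  have hc: "h \<in> carrier R" and vc: "v \<in> carrier R" using e(1) u by (auto simp: h_def v_def)
  have hh: "h \<otimes> h = h" unfolding h_def using e(1) e(2) by algebra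
  have hq: "q \<otimes> h = h \<otimes> q" and qh: "q \<otimes> h = u \<otimes> h" and hu: "q \<otimes> h = h \<otimes> u"
    unfolding h_def e(4) using e(1) qc rules by algebra+
  have vu: "v \<otimes> u = \<one>" and uv: "u \<otimes> v = \<one>" using u by (auto simp: v_def)
  have 1: "v \<otimes> (q \<otimes> h) = h" unfolding qh using uc vc hc vu by (simp add: m_assoc[symmetric])
  have 2: "q \<otimes> h \<otimes> v = h" unfolding hu using uc vc hc uv by (simp add: m_assoc)
  have "q \<otimes> h \<in> nilpotents R" by (rule nilpotents_mult_commute[OF e(3) hc hq])
  then have "q \<otimes> h \<otimes> v \<in> nilpotents R" using nilpotents_mult_commute[of "q \<otimes> h" v] vc 1 2 by simp
  then have "h = \<zero>" using 2 hh idempotent_nilpotent_zero by simp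
  moreover have "\<one> = h \<oplus> e" unfolding h_def using e(1) by algebra
  ultimately have "u \<ominus> \<one> = u \<ominus> e" using e(1) by simp
  also have "\<dots> = q" unfolding e(4) using e(1) qc by algebra
  finally show "u \<ominus> \<one> \<in> nilpotents R" using e(3) by simp
qed

text \<open>
  Nicholson's argument: with an idempotent $f \in xR$ such that $(1 - f) x \in J(R)$, the idempotent
  $e = f + f x (1 - f)$ satisfies $1 - e \in (1 - x) R$ up to an element of $J(R)$.  This error is
  removed by passing to $e' = e + e d (1 - e)$.
\<close>
lemma semi_regular_exchange:
  assumes sr: "semi_regular R"
  shows "exchange_ring R"
proof (rule exchange_ringI)
  interpret J: ideal "jacobson_radical R" R by (rule ideal_jacobson_radical)
  note J_eq = quotient_eq_iff_same_a_r_cos[OF ideal_jacobson_radical]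
  fix x assume x: "x \<in> carrier R"
  have "jacobson_radical R +> x \<in> carrier (R Quot jacobson_radical R)"
    using x by (auto simp: FactRing_simps)
  then obtain Y where Y: "Y \<in> carrier (R Quot jacobson_radical R)"
    "jacobson_radical R +> x = (jacobson_radical R +> x) \<otimes>\<^bsub>R Quot jacobson_radical R\<^esub> Y
      \<otimes>\<^bsub>R Quot jacobson_radical R\<^esub> (jacobson_radical R +> x)"
    using sr unfolding semi_regular_def von_neumann_regular_def by blast
  from Y(1) obtain y where y: "y \<in> carrier R" "Y = jacobson_radical R +> y"
    by (auto simp: FactRing_simps)
  have "jacobson_radical R +> x = jacobson_radical R +> (x \<otimes> y \<otimes> x)"
    using Y(2) x y(1) unfolding y(2) by (simp add: FactRing_simps J.rcoset_mult_add)
  then have reg: "x \<ominus> x \<otimes> y \<otimes> x \<in> jacobson_radical R" using J_eq x y(1) by simp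
  have "x \<otimes> y \<otimes> (x \<otimes> y) \<ominus> x \<otimes> y = \<ominus> ((x \<ominus> x \<otimes> y \<otimes> x) \<otimes> y)"
    using x y(1) by algebra
  also have "\<dots> \<in> jacobson_radical R" by (rule J.a_inv_closed[OF J.I_r_closed[OF reg y(1)]])
  finally have "jacobson_radical R +> (x \<otimes> y \<otimes> (x \<otimes> y)) = jacobson_radical R +> (x \<otimes> y)"
    using J_eq x y(1) by simp
  then have "jacobson_radical R +> (x \<otimes> y) \<in> idempotents (R Quot jacobson_radical R)"
    using x y(1) by (auto simp: idempotents_def FactRing_simps J.rcoset_mult_add)
  then obtain g where "g \<in> idempotents R" "jacobson_radical R +> g = jacobson_radical R +> (x \<otimes> y)"
    using sr unfolding semi_regular_def idempotents_lift_modulo_def by blast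
  then have g: "g \<in> carrier R" "g \<otimes> g = g" and gxy: "g \<ominus> x \<otimes> y \<in> jacobson_radical R"
    using J_eq x y(1) by (auto simp: idempotents_def)
  \<comment> \<open>The lifted idempotent g need not lie in xR. The unit u satisfies ug = xyg, so
    the conjugate f of g by u does lie in xR, and it keeps the class of g because u is 1 modulo
    J(R).\<close>
  define u where "u = \<one> \<ominus> (g \<ominus> x \<otimes> y)"
  define v where "v = inv u"
  have uU: "u \<in> Units R" unfolding u_def by (rule Units_one_minus_jacobson[OF gxy])
  then have uc: "u \<in> carrier R" and vc: "v \<in> carrier R" and vu: "v \<otimes> u = \<one>" and uv: "u \<otimes> v = \<one>"
    by (auto simp: v_def)
  have ug: "u \<otimes> g = x \<otimes> (y \<otimes> g)"
    unfolding u_def using g x y(1) by algebra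
  define f where "f = x \<otimes> (y \<otimes> g \<otimes> v)"
  have fc: "f \<in> carrier R" using x y(1) g vc by (simp add: f_def)
  have f: "f = u \<otimes> g \<otimes> v" unfolding ug f_def using x y(1) g(1) vc by (simp add: m_assoc)
  have ff: "f \<otimes> f = f"
    unfolding f using uc vc g m_assoc_rule[OF vu vc uc] m_assoc_rule[OF g(2) g(1,1)] by algebra
  \<comment> \<open>Expresses f - g through the radical element g - xy; that f recurs on the right
    is harmless, being multiplied by that element.\<close>
  have "f = f \<otimes> u \<oplus> f \<otimes> (g \<ominus> x \<otimes> y)"
    unfolding u_def using fc g(1) x y(1) by algebra
  also have "f \<otimes> u = u \<otimes> g" unfolding f using uc vc g(1) vu by (simp add: m_assoc)
  also have "u \<otimes> g \<oplus> f \<otimes> (g \<ominus> x \<otimes> y) = g \<ominus> (g \<ominus> x \<otimes> y) \<otimes> g \<oplus> f \<otimes> (g \<ominus> x \<otimes> y)"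
    unfolding u_def using fc g(1) x y(1) by algebra
  finally have f_eq: "f = g \<ominus> (g \<ominus> x \<otimes> y) \<otimes> g \<oplus> f \<otimes> (g \<ominus> x \<otimes> y)" .
  have "(\<one> \<ominus> f) \<otimes> x = (x \<ominus> x \<otimes> y \<otimes> x) \<ominus> (g \<ominus> x \<otimes> y) \<otimes> x \<oplus> (g \<ominus> f) \<otimes> x"
    using fc g(1) x y(1) by algebra
  also have "g \<ominus> f = (g \<ominus> x \<otimes> y) \<otimes> g \<ominus> f \<otimes> (g \<ominus> x \<otimes> y)" (is "_ = ?k")
  proof -
    have "?k = g \<ominus> (g \<ominus> (g \<ominus> x \<otimes> y) \<otimes> g \<oplus> f \<otimes> (g \<ominus> x \<otimes> y))"
      using fc g(1) x y(1) by algebra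
    then show ?thesis using f_eq by simp
  qed
  finally have "(\<one> \<ominus> f) \<otimes> x
      = (x \<ominus> x \<otimes> y \<otimes> x) \<ominus> (g \<ominus> x \<otimes> y) \<otimes> x \<oplus> ?k \<otimes> x" .
  moreover have "?k \<in> jacobson_radical R" unfolding minus_eq[of "(g \<ominus> x \<otimes> y) \<otimes> g"]
    by (rule J.a_closed[OF J.I_r_closed[OF gxy g(1)] J.a_inv_closed[OF J.I_l_closed[OF gxy fc]]])
  ultimately have fx: "(\<one> \<ominus> f) \<otimes> x \<in> jacobson_radical R"
    unfolding minus_eq[of "x \<ominus> x \<otimes> y \<otimes> x"]
    by (simp only: J.a_closed J.a_inv_closed J.I_r_closed reg gxy x)
  define k where "k = (\<one> \<ominus> f) \<otimes> x \<otimes> (\<one> \<ominus> f)"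
  have kJ: "k \<in> jacobson_radical R" unfolding k_def by (rule J.I_r_closed[OF fx]) (use fc in simp)
  define e where "e = f \<oplus> f \<otimes> x \<otimes> (\<one> \<ominus> f)"
  define w where "w = \<one> \<ominus> k"
  define d where "d = inv w"
  have "w \<in> Units R" unfolding w_def by (rule Units_one_minus_jacobson[OF kJ])
  then have wc: "w \<in> carrier R" and dc: "d \<in> carrier R" and wd: "w \<otimes> d = \<one>" by (auto simp: d_def)
  have ec: "e \<in> carrier R" using fc x by (simp add: e_def)
  note ffr = ff m_assoc_rule[OF ff fc fc]
  have ee: "e \<otimes> e = e" unfolding e_def using fc x ffr by algebra
  let ?c = "(\<one> \<ominus> f) \<otimes> d"
  \<comment> \<open>The summand fx(1 - f) of e cancels the same part of x(1 - f), so the sum differs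
    from 1 only by the radical corner k.\<close>
  have "e \<oplus> (\<one> \<ominus> x) \<otimes> (\<one> \<ominus> f) = w"
    unfolding e_def w_def k_def using fc x ffr by algebra
  then have "(e \<oplus> (\<one> \<ominus> x) \<otimes> (\<one> \<ominus> f)) \<otimes> d = \<one>" using wd by simp
  moreover have "(e \<oplus> (\<one> \<ominus> x) \<otimes> (\<one> \<ominus> f)) \<otimes> d = e \<otimes> d \<oplus> (\<one> \<ominus> x) \<otimes> ?c"
    using ec x fc dc by (simp only: l_distr m_assoc m_closed minus_closed one_closed)
  ultimately have sum: "e \<otimes> d \<oplus> (\<one> \<ominus> x) \<otimes> ?c = \<one>" by simp
  \<comment> \<open>Read off from \<open>sum\<close>: multiplying ed + (1 - x)c = 1 by 1 - e on the
    right leaves (1 - x)c(1 - e) = (1 - e) - ed(1 - e), which is to be 1 - e'. As e' lies in eR, it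
    stays in xR.\<close>
  define e' where "e' = e \<oplus> e \<otimes> d \<otimes> (\<one> \<ominus> e)"
  have e'c: "e' \<in> carrier R" using ec dc by (simp add: e'_def)
  have "e' \<otimes> e' = e'"
    unfolding e'_def using ec dc ee m_assoc_rule[OF ee ec ec] by algebra
  moreover have "x \<otimes> (y \<otimes> g \<otimes> v \<otimes> (\<one> \<oplus> x \<otimes> (\<one> \<ominus> f)) \<otimes> (\<one> \<oplus> d \<otimes> (\<one> \<ominus> e))) = e'"
  proof -
    have "f \<otimes> (\<one> \<oplus> x \<otimes> (\<one> \<ominus> f)) = e" unfolding e_def using fc x by algebra
    moreover have "e \<otimes> (\<one> \<oplus> d \<otimes> (\<one> \<ominus> e)) = e'" unfolding e'_def using ec dc by algebra
    moreover have "x \<otimes> (y \<otimes> g \<otimes> v \<otimes> (\<one> \<oplus> x \<otimes> (\<one> \<ominus> f)) \<otimes> (\<one> \<oplus> d \<otimes> (\<one> \<ominus> e)))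
        = f \<otimes> (\<one> \<oplus> x \<otimes> (\<one> \<ominus> f)) \<otimes> (\<one> \<oplus> d \<otimes> (\<one> \<ominus> e))"
      unfolding f_def[symmetric] using x y(1) g(1) vc dc ec fc f_def by (simp add: m_assoc)
    ultimately show ?thesis by simp
  qed
  moreover have "(\<one> \<ominus> x) \<otimes> (?c \<otimes> (\<one> \<ominus> e)) = \<one> \<ominus> e'"
  proof -
    have "(\<one> \<ominus> x) \<otimes> ?c = (e \<otimes> d \<oplus> (\<one> \<ominus> x) \<otimes> ?c) \<ominus> e \<otimes> d"
      using ec x fc dc by algebra
    then have "(\<one> \<ominus> x) \<otimes> ?c = \<one> \<ominus> e \<otimes> d" using sum by simp
    then have "(\<one> \<ominus> x) \<otimes> (?c \<otimes> (\<one> \<ominus> e)) = (\<one> \<ominus> e \<otimes> d) \<otimes> (\<one> \<ominus> e)"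
      using ec x fc dc m_assoc[of "\<one> \<ominus> x" ?c "\<one> \<ominus> e"] by simp
    also have "\<dots> = \<one> \<ominus> e'" unfolding e'_def using ec dc by algebra
    finally show ?thesis .
  qed
  ultimately show "\<exists>e\<in>carrier R. \<exists>r\<in>carrier R. \<exists>s\<in>carrier R.
      e \<otimes> e = e \<and> x \<otimes> r = e \<and> (\<one> \<ominus> x) \<otimes> s = \<one> \<ominus> e"
    by (intro bexI[of _ e'] bexI[of _ "y \<otimes> g \<otimes> v \<otimes> (\<one> \<oplus> x \<otimes> (\<one> \<ominus> f)) \<otimes> (\<one> \<oplus> d \<otimes> (\<one> \<ominus> e))"]
        bexI[of _ "?c \<otimes> (\<one> \<ominus> e)"] conjI) (use e'c ec x y(1) g(1) vc fc dc in simp_all)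
qed

end

context exchange_unipotent
begin

lemma minus_square_nilpotent: "a \<in> carrier R \<Longrightarrow> a \<ominus> a \<otimes> a \<in> nilpotents R"
  using minus_square_jacobson UJ_sharp_iff_unipotent_units uu by (auto simp: nil_subset_def)

lemma semi_regular: "semi_regular R"
proof -
  interpret J: ideal "jacobson_radical R" R by (rule ideal_jacobson_radical)
  note J_eq = quotient_eq_iff_same_a_r_cos[OF ideal_jacobson_radical]
  let ?Q = "R Quot jacobson_radical R"
  have sq: "jacobson_radical R +> a = jacobson_radical R +> (a \<otimes> a)" if "a \<in> carrier R" for a
    using minus_square_jacobson[OF that] J_eq that by simp
  have "von_neumann_regular ?Q" unfolding von_neumann_regular_def
  proof
    interpret Q: ring ?Q by (rule J.quotient_is_ring)
    fix A assume A: "A \<in> carrier ?Q"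
    then obtain a where a: "a \<in> carrier R" "A = jacobson_radical R +> a" by (auto simp: FactRing_simps)
    have "A \<otimes>\<^bsub>?Q\<^esub> A = jacobson_radical R +> (a \<otimes> a)"
      unfolding a(2) using a(1) by (simp add: FactRing_simps J.rcoset_mult_add)
    then have "A = A \<otimes>\<^bsub>?Q\<^esub> A" unfolding a(2) using sq[OF a(1)] by simp
    \<comment> \<open>In a Boolean quotient the identity serves as inner inverse of every
      class.\<close>
    then have "A = A \<otimes>\<^bsub>?Q\<^esub> \<one>\<^bsub>?Q\<^esub> \<otimes>\<^bsub>?Q\<^esub> A" using Q.r_one[OF A] by simp
    then show "\<exists>x\<in>carrier ?Q. A = A \<otimes>\<^bsub>?Q\<^esub> x \<otimes>\<^bsub>?Q\<^esub> A" using Q.one_closed by blast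
  qed
  moreover have "idempotents_lift_modulo (jacobson_radical R) R"
    unfolding idempotents_lift_modulo_def
  proof
    fix F assume "F \<in> idempotents ?Q"
    then obtain a where a: "a \<in> carrier R" "F = jacobson_radical R +> a"
      by (auto simp: idempotents_def FactRing_simps)
    obtain e r s where e: "e \<in> carrier R" "r \<in> carrier R" "s \<in> carrier R" "e \<otimes> e = e"
      "a \<otimes> r = e" "(\<one> \<ominus> a) \<otimes> s = \<one> \<ominus> e" "a \<ominus> e \<in> nilpotents R" "a \<otimes> e = e \<otimes> a"
      by (rule lift_idempotent[OF a(1) minus_square_nilpotent[OF a(1)]])
    have "jacobson_radical R +> e = F"
      using nilpotent_imp_jacobson[OF e(7)] J_eq[OF a(1) e(1)] a(2) by simp
    then show "\<exists>e\<in>idempotents R. jacobson_radical R +> e = F"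
      using e(1,4) by (auto simp: idempotents_def)
  qed
  ultimately show ?thesis by (simp add: semi_regular_def)
qed

end

theorem corollary3p6:
  fixes R :: "('a, 'b) ring_scheme"
  assumes "ring R"
  shows "(semi_regular R \<and> UJ_sharp R \<and> nil_subset (jacobson_radical R) R
            \<longleftrightarrow> exchange_ring R \<and> UJ_sharp R \<and> nil_subset (jacobson_radical R) R) \<and>
         (exchange_ring R \<and> UJ_sharp R \<and> nil_subset (jacobson_radical R) R
            \<longleftrightarrow> strongly_nil_clean R)"
proof -
  interpret ring R by fact
  \<comment> \<open>The exchange property with unipotent units is the hub: it implies the other two
    statements here, and each of them leads back to it.\<close>
  have "semi_regular R" "strongly_nil_clean R" if "exchange_ring R" "unipotent_units R"
  proof -
    interpret exchange_unipotent R using that by unfold_locales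
    show "semi_regular R" by (rule semi_regular)
    show "strongly_nil_clean R"
      by (rule minus_square_nilpotent_strongly_nil_clean) (rule minus_square_nilpotent)
  qed
  then show ?thesis unfolding UJ_sharp_iff_unipotent_units
    using semi_regular_exchange strongly_nil_clean_exchange strongly_nil_clean_unipotent_units
    by blast
qed

end
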